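(* For any finite simple undirected graph $G$ of order $n\ge 1$ and maximum degree $\Delta$, $\kappa(G)\le \frac{n\Delta}{\Delta+1}$.
   Context: For a graph $G=(V,E)$ and $C\subseteq V$, let $Odd(C)=\{v\in V : |N(v)\cap C|\equiv 1 \pmod 2\}$, where $N(v)$ is the open neighborhood of $v$. A set $B\subseteq V$ is a weak odd dominated (WOD) set if there exists $C\subseteq V\setminus B$ with $B\subseteq Odd(C)$. $\kappa(G)$ is the maximum size of a WOD set of $G$. *)

theory Defs
  imports Complex_Main "Graph_Theory.Digraph"
begin

text \<open>
  Finite simple undirected graphs are the locale \<^locale>\<open>graph\<close> of the Graph Theory entry:
  finite, loop-free, without parallel arcs and symmetric, every undirected edge being
  represented by its two opposite arcs. The degree of a vertex is thus its
  \<^const>\<open>out_degree\<close>; see \<open>out_degree_eq_card_nbhd\<close> below.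
\<close>

definition nbhd :: "('a,'b) pre_digraph \<Rightarrow> 'a \<Rightarrow> 'a set" where
  "nbhd G v = {u \<in> verts G. v \<rightarrow>\<^bsub>G\<^esub> u}"

definition odd_nbhd :: "('a,'b) pre_digraph \<Rightarrow> 'a set \<Rightarrow> 'a set" where
  "odd_nbhd G C = {v \<in> verts G. odd (card (nbhd G v \<inter> C))}"

definition WOD_set :: "('a,'b) pre_digraph \<Rightarrow> 'a set \<Rightarrow> bool" where
  "WOD_set G B \<longleftrightarrow> B \<subseteq> verts G \<and> (\<exists>C. C \<subseteq> verts G - B \<and> B \<subseteq> odd_nbhd G C)"

definition kappa :: "('a,'b) pre_digraph \<Rightarrow> nat" where
  "kappa G = Max (card ` {B. WOD_set G B})"

definition max_degree :: "('a,'b) pre_digraph \<Rightarrow> nat" where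
  "max_degree G = Max (out_degree G ` verts G)"

lemma (in nomulti_digraph) out_degree_eq_card_nbhd: "out_degree G v = card (nbhd G v)"
proof -
  have "nbhd G v = head G ` out_arcs G v"
    by (auto simp: nbhd_def arcs_ends_conv)
  moreover have "inj_on (head G) (out_arcs G v)"
    by (auto intro!: inj_onI no_multi_arcs simp: arc_to_ends_def)
  ultimately show ?thesis
    by (simp add: out_degree_def card_image)
qed

text \<open>The maximum in \<^const>\<open>kappa\<close> ranges over a finite nonempty set.\<close>

lemma (in fin_digraph) finite_WOD_sets: "finite {B. WOD_set G B}"
  by (rule finite_subset[of _ "Pow (verts G)"]) (auto simp: WOD_set_def)

lemma WOD_set_empty: "WOD_set G {}"
  by (auto simp: WOD_set_def)

end

theory Submission
  imports Defs
begin

text \<open>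
  If \<open>C\<close> witnesses that \<open>B\<close> is a WOD set, every vertex of \<open>B\<close> has a neighbour in \<open>C\<close>, so the
  neighbourhoods of the at most \<open>n - |B|\<close> vertices of \<open>C\<close> cover \<open>B\<close>, whence
  \<open>|B| \<le> \<Delta> (n - |B|)\<close>.
\<close>

lemma (in graph) nbhd_sym: "v \<in> nbhd G u \<Longrightarrow> u \<in> nbhd G v"
  using sym_arcs by (auto simp: nbhd_def symmetric_def dest: adj_in_verts symD)

lemma (in fin_digraph) out_degree_le_max_degree:
  "v \<in> verts G \<Longrightarrow> out_degree G v \<le> max_degree G"
  by (simp add: max_degree_def)

text \<open>An odd cardinality is nonzero, so such a vertex has a neighbour in \<open>C\<close>;
  symmetry of adjacency then puts the vertex into that neighbour's neighbourhood.\<close>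

lemma (in graph) odd_nbhd_subset_UN_nbhd: "odd_nbhd G C \<subseteq> (\<Union>c\<in>C. nbhd G c)"
proof
  fix v assume "v \<in> odd_nbhd G C"
  then have "nbhd G v \<inter> C \<noteq> {}"
    by (auto simp: odd_nbhd_def)
  then show "v \<in> (\<Union>c\<in>C. nbhd G c)"
    using nbhd_sym by blast
qed

lemma (in graph) card_WOD_set_le:
  assumes "WOD_set G B"
  shows "card B \<le> (card (verts G) - card B) * max_degree G"
proof -
  obtain C where C: "C \<subseteq> verts G - B" "B \<subseteq> odd_nbhd G C" and B: "B \<subseteq> verts G"
    using assms by (auto simp: WOD_set_def)
  have fin: "finite C"
    using C(1) finite_verts by (meson finite_Diff finite_subset)
  have "finite (\<Union>c\<in>C. nbhd G c)"
    using fin by (simp add: nbhd_def)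
  then have "card B \<le> card (\<Union>c\<in>C. nbhd G c)"
    by (rule card_mono) (use C(2) odd_nbhd_subset_UN_nbhd in blast)
  also have "\<dots> \<le> (\<Sum>c\<in>C. card (nbhd G c))"
    by (rule card_UN_le[OF fin])
  also have "\<dots> \<le> card C * max_degree G"
    using sum_bounded_above[of C "\<lambda>c. card (nbhd G c)" "max_degree G"] C(1)
    by (auto simp flip: out_degree_eq_card_nbhd intro: out_degree_le_max_degree)
  \<comment> \<open>Here the disjointness of \<open>C\<close> from \<open>B\<close> enters.\<close>
  also have "card C \<le> card (verts G) - card B"
    using card_mono[OF _ C(1)] B by (simp add: card_Diff_subset finite_subset)
  finally show ?thesis by simp
qed

text \<open>Reduces a bound on \<open>kappa G\<close> to a bound on a single WOD set.\<close>

lemma (in fin_digraph) kappa_attained: "\<exists>B. WOD_set G B \<and> kappa G = card B"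
proof -
  have "Max (card ` {B. WOD_set G B}) \<in> card ` {B. WOD_set G B}"
    by (rule Max_in) (use finite_WOD_sets WOD_set_empty in auto)
  then show ?thesis
    by (auto simp: kappa_def)
qed

theorem lemma4:
  fixes G :: "('a, 'b) pre_digraph" and n \<Delta> :: nat
  assumes "graph G"
    and "n = card (verts G)" and "n \<ge> 1"
    and "\<Delta> = max_degree G"
  shows "real (kappa G) \<le> real n * real \<Delta> / (real \<Delta> + 1)"
proof -
  interpret graph G by fact
  obtain B where B: "WOD_set G B" and \<kappa>: "kappa G = card B"
    using kappa_attained by blast
  \<comment> \<open>Makes the truncated subtraction \<open>n - card B\<close> agree with the real
    one, so that the counting bound rearranges to |B| (\<Delta> + 1) \<le> n \<Delta>.\<close>
  have "card B \<le> n"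
    using B assms(2) by (auto simp: WOD_set_def intro: card_mono)
  moreover have "real (card B) \<le> real ((n - card B) * \<Delta>)"
    unfolding of_nat_le_iff using card_WOD_set_le[OF B] assms(2,4) by simp
  ultimately show ?thesis
    by (simp add: \<kappa> of_nat_diff field_simps)
qed

end
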